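(* For any $x>0$ such that $0<F(x)<1$, we have the convergence in distribution $$n^{1/2}\big(\hat F_{n,b}^{\mathrm{LN}}(x)-\mathbb{E}[\hat F_{n,b}^{\mathrm{LN}}(x)]\big)\xrightarrow{\ \mathscr D\ }\mathcal N(0,\sigma^2(x)),\quad\text{as } b\to0,\ n\to\infty,$$ where $\sigma^2(x):=F(x)(1-F(x))$. In particular, $$n^{1/2}\big(\hat F_{n,b}^{\mathrm{LN}}(x)-F(x)\big)\xrightarrow{\ \mathscr D\ }\mathcal N(0,\sigma^2(x)),\quad\text{if } n^{1/2}b\to0,$$ $$n^{1/2}\big(\hat F_{n,b}^{\mathrm{LN}}(x)-F(x)\big)\xrightarrow{\ \mathscr D\ }\mathcal N\Big(\lambda\cdot\frac{x}{2}(f(x)+xf'(x)),\sigma^2(x)\Big),\quad\text{if } n^{1/2}b\to\lambda,$$ for any constant $\lambda>0$.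
   Context: $F$ is a cumulative distribution function supported on $[0,\infty)$ having two continuous and bounded derivatives; $f=F'$. $X_1,X_2,\dots$ are i.i.d. with c.d.f. $F$. The smoothing parameter $b=b_n>0$ satisfies $b\to0$ as $n\to\infty$. The lognormal kernel c.d.f. estimator is $$\hat F_{n,b}^{\mathrm{LN}}(x):=\frac1n\sum_{i=1}^n\overline K_{\mathrm{LN}}(X_i\mid\log x,\sqrt b),\qquad \overline K_{\mathrm{LN}}(t\mid\mu,\sigma):=1-\Phi\Big(\frac{\log t-\mu}{\sigma}\Big),$$ where $\Phi$ is the c.d.f. of the standard normal distribution. $\mathcal N(m,s^2)$ is the normal distribution with mean $m$ and variance $s^2$; $\xrightarrow{\mathscr D}$ denotes convergence in law. *)

theory Defs
  imports "HOL-Probability.Probability"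
begin

definition std_normal_cdf :: "real \<Rightarrow> real" where
  "std_normal_cdf = cdf std_normal_distribution"

text \<open>
  The survival function of the lognormal law. The formula with the logarithm is meant for
  \<open>t > 0\<close>; at \<open>t = 0\<close> it is read with the usual convention \<open>log 0 = -\<infinity>\<close>, which gives the value
  \<open>1\<close>. This is spelled out because \<^term>\<open>ln (0::real)\<close> is \<open>0\<close> in HOL, which would give
  a different value. Negative \<open>t\<close> occur only with probability zero for nonnegative data.
\<close>

definition lognormal_survival :: "real \<Rightarrow> real \<Rightarrow> real \<Rightarrow> real" where
  "lognormal_survival t \<mu> \<sigma> = (if t > 0 then 1 - std_normal_cdf ((ln t - \<mu>) / \<sigma>) else 1)"

text \<open>
  The sample \<open>X\<^sub>1, \<dots>, X\<^sub>n\<close> is represented by \<open>X 0, \<dots>, X (n - 1)\<close>; \<open>\<omega>\<close> is the sample point.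
\<close>

definition lognormal_cdf_estimator ::
  "(nat \<Rightarrow> 'a \<Rightarrow> real) \<Rightarrow> nat \<Rightarrow> real \<Rightarrow> real \<Rightarrow> 'a \<Rightarrow> real" where
  "lognormal_cdf_estimator X n b x \<omega> =
     (1 / real n) * (\<Sum>i<n. lognormal_survival (X i \<omega>) (ln x) (sqrt b))"

text \<open>The parameter \<open>v\<close> is the variance, whereas \<^const>\<open>normal_density\<close> takes the standard deviation.\<close>

definition normal_distribution :: "real \<Rightarrow> real \<Rightarrow> real measure" where
  "normal_distribution m v = density lborel (normal_density m (sqrt v))"

definition converges_in_law ::
  "'a measure \<Rightarrow> (nat \<Rightarrow> 'a \<Rightarrow> real) \<Rightarrow> real measure \<Rightarrow> bool" where
  "converges_in_law M Y \<mu> \<longleftrightarrow> weak_conv_m (\<lambda>n. distr M borel (Y n)) \<mu>"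

end

(*
  The estimator is n^(-1) times the sum of K_n(X_i), where K_n(t) = P(t < x exp(sqrt b Z)) for a
  standard normal Z. The function K_n tends to the indicator of {..x} except at t = x, which is not
  an atom, so K_n(X_1) tends to the indicator of X_1 <= x in L^2. By independence the centred and
  normalised sums of the two differ by o(1) in L^2, and the limit law of the smoothed estimator is
  that of the empirical distribution function, given by the i.i.d. central limit theorem; no
  Lindeberg condition for triangular arrays is needed.

  For the bias, Fubini gives E K_n(X_1) = E h(sqrt b Z) with h(s) = F(x exp s). The second-order
  Taylor quotient of the bounded function h at 0 is bounded and tends to
  h''(0) / 2 = x (f(x) + x f'(x)) / 2, and dominated convergence yields
  (E K_n(X_1) - F(x)) / b -> h''(0) / 2.
*)
theory Submission
  imports Defs
begin

section \<open>Convergence in law under affine maps and small perturbations; normal laws\<close>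

text \<open>The characteristic function of \<open>a + s * V\<close> at \<open>t\<close> is
  \<open>iexp (t * a)\<close> times that of \<open>V\<close> at \<open>t * s\<close>, so pointwise
  convergence of characteristic functions carries over and Levy's continuity theorem
  applies.\<close>

lemma converges_in_law_affine:
  assumes "prob_space M" "\<And>n. W n \<in> borel_measurable M"
    and "real_distribution \<mu>" "converges_in_law M W \<mu>"
  shows "converges_in_law M (\<lambda>n \<omega>. a + s * W n \<omega>) (distr \<mu> borel (\<lambda>z. a + s * z))"
proof -
  interpret prob_space M by fact
  interpret N: real_distribution \<mu> by fact
  note [measurable] = assms(2)
  have char_affine: "char (distr L borel (\<lambda>z. a + s * V z)) t = iexp (t * a) * char (distr L borel V) (t * s)"
    if [measurable]: "V \<in> borel_measurable L" for L :: "'c measure" and V t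
    by (simp add: char_def integral_distr distrib_left exp_add mult.assoc)
  show ?thesis
    unfolding converges_in_law_def
  proof (rule levy_continuity)
    fix t
    have "(\<lambda>n. char (distr M borel (W n)) (t * s)) \<longlonglongrightarrow> char \<mu> (t * s)"
      using assms by (intro levy_continuity1) (auto simp: converges_in_law_def)
    then have "(\<lambda>n. iexp (t * a) * char (distr M borel (W n)) (t * s))
        \<longlonglongrightarrow> iexp (t * a) * char (distr \<mu> borel (\<lambda>z. z)) (t * s)"
      by (intro tendsto_mult tendsto_const) (simp add: distr_id2 N.M_is_borel)
    then show "(\<lambda>n. char (distr M borel (\<lambda>\<omega>. a + s * W n \<omega>)) t)
        \<longlonglongrightarrow> char (distr \<mu> borel (\<lambda>z. a + s * z)) t"
      by (subst (1 2) char_affine) simp_all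
  qed (auto intro!: real_distribution_distr N.real_distribution_distr)
qed

lemma norm_iexp_diff_le: "norm (iexp u - iexp v) \<le> \<bar>u - v\<bar>" for u v :: real
proof -
  have "iexp u - iexp v = iexp v * (iexp (u - v) - 1)"
    by (simp add: algebra_simps flip: exp_add)
  then have "norm (iexp u - iexp v) = norm (iexp (u - v) - 1)"
    by (simp add: norm_mult)
  also have "\<dots> \<le> \<bar>u - v\<bar>"
    using iexp_approx1[of "u - v" 0] by simp
  finally show ?thesis .
qed

text \<open>A Slutsky-type statement with closeness measured in L^1. Since \<open>iexp\<close> is
  1-Lipschitz on the real line, the characteristic functions of \<open>Y n\<close> and
  \<open>W n\<close> at \<open>t\<close> differ by at most \<open>\<bar>t\<bar>\<close> times the
  L^1 distance, which tends to 0.\<close>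

lemma converges_in_law_perturb:
  assumes "prob_space M"
    and W: "\<And>n. W n \<in> borel_measurable M" and Y: "\<And>n. Y n \<in> borel_measurable M"
    and "real_distribution \<mu>" and lim: "converges_in_law M W \<mu>"
    and int: "\<And>n. integrable M (\<lambda>\<omega>. Y n \<omega> - W n \<omega>)"
    and L1: "(\<lambda>n. \<integral>\<omega>. \<bar>Y n \<omega> - W n \<omega>\<bar> \<partial>M) \<longlonglongrightarrow> 0"
  shows "converges_in_law M Y \<mu>"
proof -
  interpret prob_space M by fact
  interpret N: real_distribution \<mu> by fact
  note [measurable] = W Y
  show ?thesis
    unfolding converges_in_law_def
  proof (rule levy_continuity)
    fix t
    have *: "(\<lambda>n. char (distr M borel (W n)) t) \<longlonglongrightarrow> char \<mu> t"
      using assms by (intro levy_continuity1) (auto simp: converges_in_law_def)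
    have "norm (char (distr M borel (Y n)) t - char (distr M borel (W n)) t)
        \<le> \<bar>t\<bar> * (\<integral>\<omega>. \<bar>Y n \<omega> - W n \<omega>\<bar> \<partial>M)" for n
    proof -
      have int_iexp: "integrable M (\<lambda>\<omega>. iexp (t * V \<omega>))" if [measurable]: "V \<in> borel_measurable M" for V
        by (rule integrable_const_bound[of _ 1]) auto
      have "char (distr M borel (Y n)) t - char (distr M borel (W n)) t
          = (\<integral>\<omega>. iexp (t * Y n \<omega>) - iexp (t * W n \<omega>) \<partial>M)"
        unfolding char_def
        by (subst Bochner_Integration.integral_diff) (simp_all add: integral_distr int_iexp W Y del: of_real_mult)
      also have "norm \<dots> \<le> (\<integral>\<omega>. norm (iexp (t * Y n \<omega>) - iexp (t * W n \<omega>)) \<partial>M)"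
        by (rule integral_norm_bound)
      also have "\<dots> \<le> (\<integral>\<omega>. \<bar>t\<bar> * \<bar>Y n \<omega> - W n \<omega>\<bar> \<partial>M)"
      proof (rule integral_mono)
        show "integrable M (\<lambda>\<omega>. norm (iexp (t * Y n \<omega>) - iexp (t * W n \<omega>)))"
          by (intro integrable_norm Bochner_Integration.integrable_diff int_iexp W Y)
        show "integrable M (\<lambda>\<omega>. \<bar>t\<bar> * \<bar>Y n \<omega> - W n \<omega>\<bar>)"
          by (intro integrable_mult_right integrable_abs int)
        show "norm (iexp (t * Y n \<omega>) - iexp (t * W n \<omega>)) \<le> \<bar>t\<bar> * \<bar>Y n \<omega> - W n \<omega>\<bar>" for \<omega>
          using norm_iexp_diff_le[of "t * Y n \<omega>" "t * W n \<omega>"]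
          by (metis abs_mult right_diff_distrib)
      qed
      finally show ?thesis by simp
    qed
    moreover have "(\<lambda>n. \<bar>t\<bar> * (\<integral>\<omega>. \<bar>Y n \<omega> - W n \<omega>\<bar> \<partial>M)) \<longlonglongrightarrow> 0"
      using tendsto_mult[OF tendsto_const L1, of "\<bar>t\<bar>"] by simp
    ultimately have "(\<lambda>n. char (distr M borel (Y n)) t - char (distr M borel (W n)) t) \<longlonglongrightarrow> 0"
      by (rule Lim_null_comparison[OF always_eventually[OF allI]])
    from tendsto_add[OF this *] show "(\<lambda>n. char (distr M borel (Y n)) t) \<longlonglongrightarrow> char \<mu> t"
      by simp
  qed (auto intro!: real_distribution_distr N.real_distribution_axioms)
qed

text \<open>Presents every nondegenerate normal law as an affine image of the standard one, the form
  in which affine images of weak limits arise below.\<close>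

lemma normal_distribution_eq_distr:
  assumes "v > 0"
  shows "normal_distribution m v = distr std_normal_distribution borel (\<lambda>z. m + sqrt v * z)"
proof -
  interpret N: real_distribution std_normal_distribution
    by (rule real_dist_normal_dist)
  have "distributed std_normal_distribution lborel (\<lambda>z. z) std_normal_density"
    by (auto simp: distributed_def distr_id2)
  from N.normal_density_affine[OF this, of "sqrt v" m] assms
  have "distr std_normal_distribution lborel (\<lambda>z. m + sqrt v * z) = normal_distribution m v"
    by (auto simp: distributed_def normal_distribution_def)
  then show ?thesis
    \<comment> \<open>\<open>distr\<close> depends on its target only through the measurable sets,
      and these agree for \<open>lborel\<close> and \<open>borel\<close>.\<close>
    by (metis distr_cong sets_lborel)
qed

lemma real_distribution_normal_distribution:
  "v > 0 \<Longrightarrow> real_distribution (normal_distribution m v)"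
  using real_distribution.axioms(1)[OF real_dist_normal_dist]
  by (auto simp: normal_distribution_eq_distr intro!: prob_space.real_distribution_distr)

section \<open>Second moments of sums of independent centred variables\<close>

text \<open>Pythagoras in L^2: \<open>Z i\<close> is independent of the sum over the remaining
  indices, so the expectation of their product factors and vanishes. Integrability is part of the
  conclusion because the induction step needs it to split the expectation.\<close>

lemma (in prob_space) expectation_sum_power2:
  fixes Z :: "'i \<Rightarrow> 'a \<Rightarrow> real"
  assumes "finite A" "indep_vars (\<lambda>_. borel) Z A"
    and "\<And>i. i \<in> A \<Longrightarrow> expectation (Z i) = 0"
    and "\<And>i. i \<in> A \<Longrightarrow> integrable M (\<lambda>\<omega>. (Z i \<omega>)\<^sup>2)"
  shows "integrable M (\<lambda>\<omega>. (\<Sum>i\<in>A. Z i \<omega>)\<^sup>2) \<and>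
    expectation (\<lambda>\<omega>. (\<Sum>i\<in>A. Z i \<omega>)\<^sup>2) = (\<Sum>i\<in>A. expectation (\<lambda>\<omega>. (Z i \<omega>)\<^sup>2))"
  using assms
proof (induction A)
  case (insert i A)
  have meas: "Z j \<in> borel_measurable M" if "j \<in> insert i A" for j
    using insert.prems(1) that by (auto simp: indep_vars_def2)
  have int: "integrable M (Z j)" if "j \<in> insert i A" for j
    by (rule square_integrable_imp_integrable[OF meas[OF that] insert.prems(3)[OF that]])
  have IH: "integrable M (\<lambda>\<omega>. (\<Sum>j\<in>A. Z j \<omega>)\<^sup>2)"
    "expectation (\<lambda>\<omega>. (\<Sum>j\<in>A. Z j \<omega>)\<^sup>2) = (\<Sum>j\<in>A. expectation (\<lambda>\<omega>. (Z j \<omega>)\<^sup>2))"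
    using insert.IH[OF indep_vars_subset[OF insert.prems(1)]] insert.prems(2,3) by blast+
  have indep: "indep_var borel (Z i) borel (\<lambda>\<omega>. \<Sum>j\<in>A. Z j \<omega>)"
    using insert.hyps insert.prems(1) by (intro indep_vars_sum) auto
  have prod: "integrable M (\<lambda>\<omega>. Z i \<omega> * (\<Sum>j\<in>A. Z j \<omega>))"
    "expectation (\<lambda>\<omega>. Z i \<omega> * (\<Sum>j\<in>A. Z j \<omega>)) = 0"
    using indep_var_integrable[OF indep] indep_var_lebesgue_integral[OF indep] int insert.prems(2)
    by auto
  have "(\<Sum>j\<in>insert i A. Z j \<omega>)\<^sup>2 =
      (Z i \<omega>)\<^sup>2 + (\<Sum>j\<in>A. Z j \<omega>)\<^sup>2 + 2 * (Z i \<omega> * (\<Sum>j\<in>A. Z j \<omega>))" for \<omega>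
    using insert.hyps by (simp add: power2_sum)
  then show ?case
    using IH prod insert.prems(3) insert.hyps by simp
qed auto

text \<open>By orthogonality the second moment of the sum is at most \<open>n * c\<close>, which the
  factor \<open>1 / sqrt n\<close> turns into a bound uniform in \<open>n\<close>; Cauchy-Schwarz
  passes from the second to the first absolute moment.\<close>

lemma (in prob_space) expectation_abs_normalized_sum_le:
  fixes Z :: "nat \<Rightarrow> 'a \<Rightarrow> real"
  assumes indep: "indep_vars (\<lambda>_. borel) Z UNIV"
    and mean: "\<And>i. expectation (Z i) = 0"
    and sq: "\<And>i. integrable M (\<lambda>\<omega>. (Z i \<omega>)\<^sup>2)" "\<And>i. expectation (\<lambda>\<omega>. (Z i \<omega>)\<^sup>2) \<le> c"
  shows "expectation (\<lambda>\<omega>. \<bar>(\<Sum>i<n. Z i \<omega>) / sqrt n\<bar>) \<le> sqrt c"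
proof -
  \<comment> \<open>Settles \<open>n = 0\<close>, where the left side of the claim is 0.\<close>
  have c: "0 \<le> c"
    using sq(2)[of 0] by (intro order_trans[OF _ sq(2)[of 0]]) simp
  show ?thesis
  proof (cases "n = 0")
    case False
    define S where "S \<omega> = (\<Sum>i<n. Z i \<omega>) / sqrt n" for \<omega>
    have meas[measurable]: "Z j \<in> borel_measurable M" for j
      using indep by (auto simp: indep_vars_def2)
    have S[measurable]: "S \<in> borel_measurable M"
      unfolding S_def by measurable
    have "integrable M (\<lambda>\<omega>. (\<Sum>i<n. Z i \<omega>)\<^sup>2) \<and>
      expectation (\<lambda>\<omega>. (\<Sum>i<n. Z i \<omega>)\<^sup>2) = (\<Sum>i<n. expectation (\<lambda>\<omega>. (Z i \<omega>)\<^sup>2))"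
      by (intro expectation_sum_power2 indep_vars_subset[OF indep] mean sq) auto
    moreover have "(\<Sum>i<n. expectation (\<lambda>\<omega>. (Z i \<omega>)\<^sup>2)) \<le> n * c"
      using sum_mono[of "{..<n}" "\<lambda>i. expectation (\<lambda>\<omega>. (Z i \<omega>)\<^sup>2)" "\<lambda>_. c"] sq by simp
    ultimately have int2: "integrable M (\<lambda>\<omega>. (S \<omega>)\<^sup>2)" and le: "expectation (\<lambda>\<omega>. (S \<omega>)\<^sup>2) \<le> c"
      using False by (simp_all add: S_def power_divide field_simps)
    have int1: "integrable M (\<lambda>\<omega>. \<bar>S \<omega>\<bar>)"
      using square_integrable_imp_integrable[OF S int2] by simp
    \<comment> \<open>Nonnegativity of this variance is the Cauchy-Schwarz inequality between the
      first and second moments of \<open>\<bar>S \<omega>\<bar>\<close>.\<close>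
    have "0 \<le> variance (\<lambda>\<omega>. \<bar>S \<omega>\<bar>)"
      by (rule Bochner_Integration.integral_nonneg) simp
    then have "(expectation (\<lambda>\<omega>. \<bar>S \<omega>\<bar>))\<^sup>2 \<le> c"
      using variance_eq[OF int1] int2 le by simp
    then show ?thesis
      unfolding S_def by (simp add: real_le_rsqrt)
  qed (use c in simp)
qed

section \<open>Taylor expansion and smoothing by a small normal variable\<close>

text \<open>One application of l'Hopital's rule leaves half the difference quotient of
  \<open>h1\<close> at 0. Its limit is the definition of the derivative there, so \<open>h1\<close>
  has to be differentiable at 0 only.\<close>

lemma second_order_quotient_tendsto:
  fixes h h1 :: "real \<Rightarrow> real"
  assumes h: "\<And>s. (h has_real_derivative h1 s) (at s)"
    and h1: "(h1 has_real_derivative h2) (at 0)"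
  shows "((\<lambda>s. (h s - h 0 - h1 0 * s) / s\<^sup>2) \<longlongrightarrow> h2 / 2) (at 0)"
proof (rule lhopital)
  have "isCont h 0"
    using h by (rule DERIV_isCont)
  then have "(h \<longlongrightarrow> h 0) (at 0)"
    by (simp add: isCont_def)
  then show "((\<lambda>s. h s - h 0 - h1 0 * s) \<longlongrightarrow> 0) (at 0)"
    by (auto intro!: tendsto_eq_intros)
  show "((\<lambda>s::real. s\<^sup>2) \<longlongrightarrow> 0) (at 0)"
    by (auto intro!: tendsto_eq_intros)
  show "\<forall>\<^sub>F s in at 0. s\<^sup>2 \<noteq> (0::real)" "\<forall>\<^sub>F s in at 0. 2 * s \<noteq> (0::real)"
    by (auto simp: eventually_at_filter)
  show "\<forall>\<^sub>F s in at 0. ((\<lambda>s. h s - h 0 - h1 0 * s) has_real_derivative h1 s - h1 0) (at s)"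
    by (auto intro!: always_eventually derivative_eq_intros h)
  show "\<forall>\<^sub>F s in at 0. ((\<lambda>s::real. s\<^sup>2) has_real_derivative 2 * s) (at s)"
    by (auto intro!: always_eventually derivative_eq_intros)
  have "((\<lambda>s. (h1 s - h1 0) / s / 2) \<longlongrightarrow> h2 / 2) (at 0)"
    using h1 by (intro tendsto_divide tendsto_const) (auto simp: has_field_derivative_iff)
  then show "((\<lambda>s. (h1 s - h1 0) / (2 * s)) \<longlongrightarrow> h2 / 2) (at 0)"
    by (simp add: mult.commute)
qed

text \<open>The linear Taylor term integrates to 0 because the standard normal law has mean 0. What
  remains, after division by the variance, is the integral of
  \<open>z^2 * R (\<sigma> n * z)\<close>; a bound \<open>C\<close> on
  \<open>\<bar>R s\<bar>\<close> supplies the integrable majorant \<open>z^2 * C\<close>, and the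
  second moment 1 gives the limit.\<close>

lemma normal_smoothing_bias_tendsto:
  fixes h h1 :: "real \<Rightarrow> real" and \<sigma> :: "nat \<Rightarrow> real"
  assumes h: "\<And>s. (h has_real_derivative h1 s) (at s)"
    and h1: "(h1 has_real_derivative h2) (at 0)"
    and bounded: "\<And>s. \<bar>h s\<bar> \<le> B"
    and \<sigma>: "\<And>n. \<sigma> n > 0" "\<sigma> \<longlonglongrightarrow> 0"
  shows "(\<lambda>n. ((\<integral>z. h (\<sigma> n * z) \<partial>std_normal_distribution) - h 0) / (\<sigma> n)\<^sup>2) \<longlonglongrightarrow> h2 / 2"
proof -
  interpret N: real_distribution std_normal_distribution
    by (rule real_dist_normal_dist)
  note N_moment = integrable_std_normal_distribution_moment
  \<comment> \<open>By the convention for division by zero, \<open>R 0 = 0\<close>. This value does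
    no harm, since \<open>R (\<sigma> n * z)\<close> is always multiplied by
    \<open>z^2\<close>.\<close>
  define R where "R s = (h s - h 0 - h1 0 * s) / s\<^sup>2" for s
  have h_meas[measurable]: "h \<in> borel_measurable borel"
    using h by (intro borel_measurable_continuous_onI) (auto intro!: continuous_at_imp_continuous_on DERIV_isCont)
  have R_meas[measurable]: "R \<in> borel_measurable borel"
    unfolding R_def by measurable
  have R_lim: "(R \<longlongrightarrow> h2 / 2) (at 0)"
    unfolding R_def by (rule second_order_quotient_tendsto[OF h h1])
  have "0 \<le> B"
    using bounded[of 0] by linarith
  obtain C where C: "\<And>s. \<bar>R s\<bar> \<le> C"
  proof -
    from R_lim have "\<forall>\<^sub>F s in at 0. dist (R s) (h2 / 2) < 1"
      by (rule tendstoD) simp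
    then obtain d where d: "d > 0" "\<And>s. s \<noteq> 0 \<Longrightarrow> \<bar>s\<bar> < d \<Longrightarrow> \<bar>R s - h2 / 2\<bar> < 1"
      by (auto simp: eventually_at dist_real_def)
    \<comment> \<open>The first bracket bounds \<open>R\<close> near 0, where it stays within 1 of
      its limit. The second bounds it for \<open>d \<le> \<bar>s\<bar>\<close>, where
      \<open>h s - h 0\<close> is at most \<open>2 * B\<close> in absolute value. Adding the two
      nonnegative bounds avoids a maximum.\<close>
    have "\<bar>R s\<bar> \<le> (\<bar>h2 / 2\<bar> + 1) + (2 * B / d\<^sup>2 + \<bar>h1 0\<bar> / d)" for s
    proof -
      have pos: "0 \<le> 2 * B / d\<^sup>2 + \<bar>h1 0\<bar> / d"
        using d(1) \<open>0 \<le> B\<close> by simp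
      consider "s = 0" | "s \<noteq> 0" "\<bar>s\<bar> < d" | "d \<le> \<bar>s\<bar>"
        by linarith
      then show ?thesis
      proof cases
        case 1
        then show ?thesis
          using pos by (simp add: R_def)
      next
        case 2
        then have "\<bar>R s\<bar> \<le> \<bar>h2 / 2\<bar> + 1"
          using d(2)[of s] by linarith
        then show ?thesis
          using pos by linarith
      next
        case 3
        then have "s \<noteq> 0"
          using d(1) by auto
        have "R s = (h s - h 0) / s\<^sup>2 - h1 0 / s"
          using \<open>s \<noteq> 0\<close> by (simp add: R_def diff_divide_distrib power2_eq_square)
        also have "\<bar>\<dots>\<bar> \<le> \<bar>h s - h 0\<bar> / \<bar>s\<bar>\<^sup>2 + \<bar>h1 0\<bar> / \<bar>s\<bar>"
          by (rule order_trans[OF abs_triangle_ineq4]) simp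
        also have "\<dots> \<le> 2 * B / d\<^sup>2 + \<bar>h1 0\<bar> / d"
          using 3 d(1) \<open>0 \<le> B\<close> bounded[of s] bounded[of 0]
          by (intro add_mono frac_le power_mono) auto
        finally show ?thesis
          by linarith
      qed
    qed
    then show thesis
      by (rule that)
  qed
  have expand: "((\<integral>z. h (\<sigma> n * z) \<partial>std_normal_distribution) - h 0) / (\<sigma> n)\<^sup>2
      = (\<integral>z. z\<^sup>2 * R (\<sigma> n * z) \<partial>std_normal_distribution)" for n
  proof -
    have int_R: "integrable std_normal_distribution (\<lambda>z. z\<^sup>2 * R (\<sigma> n * z))"
    proof (rule Bochner_Integration.integrable_bound)
      show "integrable std_normal_distribution (\<lambda>z. z\<^sup>2 * C)"
        using N_moment[of 2] by simp
      show "AE z in std_normal_distribution. norm (z\<^sup>2 * R (\<sigma> n * z)) \<le> norm (z\<^sup>2 * C)"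
        using C by (auto simp: abs_mult intro!: mult_left_mono order_trans[OF C abs_ge_self])
    qed measurable
    have eq: "h (\<sigma> n * z) = h 0 + h1 0 * \<sigma> n * z + (\<sigma> n)\<^sup>2 * (z\<^sup>2 * R (\<sigma> n * z))" for z
      using \<sigma>(1)[of n] by (cases "z = 0") (auto simp: R_def power_mult_distrib)
    have "(\<integral>z. h (\<sigma> n * z) \<partial>std_normal_distribution)
        = h 0 + (\<sigma> n)\<^sup>2 * (\<integral>z. z\<^sup>2 * R (\<sigma> n * z) \<partial>std_normal_distribution)"
      unfolding eq
      using int_R N_moment[of 1] integral_std_normal_distribution_moment_odd[of 1] N.prob_space
      by simp
    then show ?thesis
      using \<sigma>(1)[of n] by simp
  qed
  have "(\<lambda>n. \<integral>z. z\<^sup>2 * R (\<sigma> n * z) \<partial>std_normal_distribution)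
      \<longlonglongrightarrow> (\<integral>z. z\<^sup>2 * (h2 / 2) \<partial>std_normal_distribution)"
  proof (rule integral_dominated_convergence[where w = "\<lambda>z. z\<^sup>2 * C"])
    show "integrable std_normal_distribution (\<lambda>z. z\<^sup>2 * C)"
      using N_moment[of 2] by simp
    show "AE z in std_normal_distribution. (\<lambda>n. z\<^sup>2 * R (\<sigma> n * z)) \<longlonglongrightarrow> z\<^sup>2 * (h2 / 2)"
    proof (rule AE_I2)
      fix z
      show "(\<lambda>n. z\<^sup>2 * R (\<sigma> n * z)) \<longlonglongrightarrow> z\<^sup>2 * (h2 / 2)"
      proof (cases "z = 0")
        case False
        have "(\<lambda>n. \<sigma> n * z) \<longlonglongrightarrow> 0"
          using tendsto_mult[OF \<sigma>(2) tendsto_const, of z] by simp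
        \<comment> \<open>\<open>R_lim\<close> is a limit along a punctured neighbourhood of 0, so
          the arguments must avoid 0 itself.\<close>
        moreover have "\<sigma> n * z \<noteq> 0" for n
          using \<sigma>(1)[of n] False by simp
        ultimately have "filterlim (\<lambda>n. \<sigma> n * z) (at 0) sequentially"
          by (simp add: filterlim_at)
        then show ?thesis
          by (intro tendsto_mult tendsto_const filterlim_compose[OF R_lim])
      qed simp
    qed
    show "AE z in std_normal_distribution. norm (z\<^sup>2 * R (\<sigma> n * z)) \<le> z\<^sup>2 * C" for n
      using C by (auto simp: abs_mult intro!: mult_left_mono)
  qed auto
  also have "(\<integral>z. z\<^sup>2 * (h2 / 2) \<partial>std_normal_distribution) = h2 / 2"
    using std_normal_distribution_even_moments(1)[of 1] by (subst integral_mult_left_zero) simp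
  finally show ?thesis
    by (simp add: expand)
qed

section \<open>The lognormal kernel: probabilistic form, bias and L^2 limit\<close>

lemma std_normal_cdf_measurable[measurable]: "std_normal_cdf \<in> borel_measurable borel"
proof -
  interpret N: real_distribution std_normal_distribution
    by (rule real_dist_normal_dist)
  show ?thesis
    unfolding std_normal_cdf_def by (intro borel_measurable_mono monoI N.cdf_nondecreasing)
qed

lemma lognormal_survival_measurable[measurable]:
  "(\<lambda>t. lognormal_survival t \<mu> \<sigma>) \<in> borel_measurable borel"
  unfolding lognormal_survival_def by measurable

lemma lognormal_survival_bounds: "0 \<le> lognormal_survival t \<mu> \<sigma>" "lognormal_survival t \<mu> \<sigma> \<le> 1"
proof -
  interpret N: real_distribution std_normal_distribution
    by (rule real_dist_normal_dist)
  show "0 \<le> lognormal_survival t \<mu> \<sigma>" "lognormal_survival t \<mu> \<sigma> \<le> 1"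
    using N.cdf_nonneg N.cdf_bounded_prob
    by (auto simp: lognormal_survival_def std_normal_cdf_def)
qed

text \<open>For \<open>t > 0\<close>, taking logarithms turns the event into an upper tail of
  \<open>z\<close>. For \<open>t \<le> 0\<close> the event is the whole line, which matches the
  value 1 set in the definition.\<close>

lemma lognormal_survival_eq_measure:
  assumes "x > 0" "\<sigma> > 0"
  shows "lognormal_survival t (ln x) \<sigma> = measure std_normal_distribution {z. t < x * exp (\<sigma> * z)}"
proof -
  interpret N: real_distribution std_normal_distribution
    by (rule real_dist_normal_dist)
  show ?thesis
  proof (cases "t > 0")
    case True
    have "t < x * exp (\<sigma> * z) \<longleftrightarrow> (ln t - ln x) / \<sigma> < z" for z
    proof -
      have "t < x * exp (\<sigma> * z) \<longleftrightarrow> ln t < ln (x * exp (\<sigma> * z))"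
        using True assms by (intro ln_less_cancel_iff[symmetric]) auto
      also have "\<dots> \<longleftrightarrow> (ln t - ln x) / \<sigma> < z"
        using assms by (simp add: ln_mult field_simps)
      finally show ?thesis .
    qed
    then have "{z. t < x * exp (\<sigma> * z)} = UNIV - {..(ln t - ln x) / \<sigma>}"
      by (simp add: set_eq_iff not_le)
    then show ?thesis
      using N.prob_compl[of "{..(ln t - ln x) / \<sigma>}"] True
      by (simp add: lognormal_survival_def std_normal_cdf_def cdf_def)
  next
    case False
    then have "t < x * exp (\<sigma> * z)" for z
      using assms(1) by (intro le_less_trans[of t 0]) auto
    then have "{z. t < x * exp (\<sigma> * z)} = UNIV"
      by simp
    then show ?thesis
      using False N.prob_space by (simp add: lognormal_survival_def)
  qed
qed

text \<open>For fixed \<open>z\<close> the threshold \<open>x * exp (\<sigma> n * z)\<close> tends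
  to \<open>x\<close>, so for \<open>t \<noteq> x\<close> the comparison with \<open>t\<close> is
  eventually that of \<open>t\<close> with \<open>x\<close>. At \<open>t = x\<close> every term
  equals 1/2, which is why that point is excluded.\<close>

lemma lognormal_survival_tendsto_indicator:
  assumes "x > 0" "t \<noteq> x" and \<sigma>: "\<And>n. \<sigma> n > 0" "\<sigma> \<longlonglongrightarrow> 0"
  shows "(\<lambda>n. lognormal_survival t (ln x) (\<sigma> n)) \<longlonglongrightarrow> indicator {..x} t"
proof -
  interpret N: real_distribution std_normal_distribution
    by (rule real_dist_normal_dist)
  have "(\<lambda>n. \<integral>z. indicator {z. t < x * exp (\<sigma> n * z)} z \<partial>std_normal_distribution)
      \<longlonglongrightarrow> (\<integral>z. indicator {..x} t \<partial>std_normal_distribution :: real)"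
  proof (rule integral_dominated_convergence[where w = "\<lambda>_. 1"])
    show "AE z in std_normal_distribution.
        (\<lambda>n. indicator {z. t < x * exp (\<sigma> n * z)} z) \<longlonglongrightarrow> (indicator {..x} t :: real)"
    proof (rule AE_I2)
      fix z
      have lim: "(\<lambda>n. x * exp (\<sigma> n * z)) \<longlonglongrightarrow> x * exp (0 * z)"
        by (intro tendsto_intros \<sigma>)
      have "\<forall>\<^sub>F n in sequentially. t < x * exp (\<sigma> n * z) \<longleftrightarrow> t \<le> x"
        using order_tendstoD[OF lim, of t] assms(2)
        by (cases "t < x") (auto elim!: eventually_mono)
      then show "(\<lambda>n. indicator {z. t < x * exp (\<sigma> n * z)} z) \<longlonglongrightarrow> (indicator {..x} t :: real)"
        by (intro tendsto_eventually) (auto elim!: eventually_mono simp: indicator_def)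
    qed
  qed (auto simp: indicator_def)
  then show ?thesis
    using N.prob_space by (simp add: lognormal_survival_eq_measure[OF assms(1) \<sigma>(1)])
qed

text \<open>Fubini for the event \<open>t < x * exp (\<sigma> * z)\<close>. The thresholds are
  positive, so continuity of the cdf is asked for at positive points only; an atom at 0 remains
  possible.\<close>

lemma integral_lognormal_survival:
  assumes "real_distribution D" "x > 0" "\<sigma> > 0" "\<And>y. y > 0 \<Longrightarrow> isCont (cdf D) y"
  shows "(\<integral>t. lognormal_survival t (ln x) \<sigma> \<partial>D)
    = (\<integral>z. cdf D (x * exp (\<sigma> * z)) \<partial>std_normal_distribution)"
proof -
  interpret D: real_distribution D by fact
  interpret N: real_distribution std_normal_distribution
    by (rule real_dist_normal_dist)
  interpret DN: pair_prob_space D std_normal_distribution ..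
  let ?I = "\<lambda>t z. indicator {(t, z). t < x * exp (\<sigma> * z)} (t, z) :: real"
  have "{p \<in> space (borel \<Otimes>\<^sub>M borel). fst p < x * exp (\<sigma> * snd p)} \<in> sets (borel \<Otimes>\<^sub>M borel)"
    by measurable
  moreover have "sets (D \<Otimes>\<^sub>M std_normal_distribution) = sets (borel \<Otimes>\<^sub>M (borel :: real measure))"
    by (intro sets_pair_measure_cong) auto
  ultimately have [measurable]: "{(t, z). t < x * exp (\<sigma> * z)} \<in> sets (D \<Otimes>\<^sub>M std_normal_distribution)"
    by (simp add: space_pair_measure case_prod_beta')
  have "(\<integral>t. lognormal_survival t (ln x) \<sigma> \<partial>D) = (\<integral>t. (\<integral>z. ?I t z \<partial>std_normal_distribution) \<partial>D)"
  proof (rule Bochner_Integration.integral_cong[OF refl])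
    fix t
    have "(\<integral>z. ?I t z \<partial>std_normal_distribution)
        = (\<integral>z. indicator {z. t < x * exp (\<sigma> * z)} z \<partial>std_normal_distribution)"
      by (simp add: indicator_def)
    then show "lognormal_survival t (ln x) \<sigma> = (\<integral>z. ?I t z \<partial>std_normal_distribution)"
      using assms by (simp add: lognormal_survival_eq_measure)
  qed
  also have "\<dots> = (\<integral>z. (\<integral>t. ?I t z \<partial>D) \<partial>std_normal_distribution)"
    by (rule DN.Fubini_integral[symmetric], rule DN.integrable_const_bound[where B=1])
      (auto simp: indicator_def)
  also have "\<dots> = (\<integral>z. cdf D (x * exp (\<sigma> * z)) \<partial>std_normal_distribution)"
  proof (rule Bochner_Integration.integral_cong[OF refl])
    fix z
    let ?y = "x * exp (\<sigma> * z)"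
    \<comment> \<open>Integrating over \<open>t\<close> yields the mass of the open ray
      \<open>{..<?y}\<close>, whereas \<open>cdf\<close> measures the closed one; they agree because
      \<open>?y\<close> is not an atom.\<close>
    have "measure D {?y} = 0"
      using assms(2,4) D.isCont_cdf[of ?y] by simp
    moreover have "measure D {..?y} = measure D {..<?y} + measure D {?y}"
      by (subst D.finite_measure_Union[symmetric]) (auto intro!: arg_cong[where f = "measure D"])
    moreover have "(\<integral>t. ?I t z \<partial>D) = (\<integral>t. indicator {..<?y} t \<partial>D)"
      by (simp add: indicator_def)
    ultimately show "(\<integral>t. ?I t z \<partial>D) = cdf D ?y"
      by (simp add: cdf_def)
  qed
  finally show ?thesis .
qed

text \<open>In the logarithmic coordinate \<open>h s = cdf D (x * exp s)\<close> the kernel is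
  normal smoothing with variance \<open>b n\<close>. The chain rule gives \<open>h1\<close>, and the
  product rule at 0 gives the second derivative \<open>x * (f x + x * f')\<close>, half of which is
  the limit.\<close>

lemma lognormal_bias_tendsto:
  assumes "real_distribution D" "x > 0"
    and F: "\<And>y. y > 0 \<Longrightarrow> (cdf D has_real_derivative f y) (at y)"
    and f: "(f has_real_derivative f') (at x)"
    and b: "\<And>n. b n > 0" "b \<longlonglongrightarrow> 0"
  shows "(\<lambda>n. ((\<integral>t. lognormal_survival t (ln x) (sqrt (b n)) \<partial>D) - cdf D x) / b n)
    \<longlonglongrightarrow> x / 2 * (f x + x * f')"
proof -
  interpret D: real_distribution D by fact
  define h where "h s = cdf D (x * exp s)" for s
  define h1 where "h1 s = f (x * exp s) * (x * exp s)" for s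
  have "(\<lambda>n. ((\<integral>z. h (sqrt (b n) * z) \<partial>std_normal_distribution) - h 0) / (sqrt (b n))\<^sup>2)
      \<longlonglongrightarrow> (x * (f x + x * f')) / 2"
  proof (rule normal_smoothing_bias_tendsto)
    show "(h has_real_derivative h1 s) (at s)" for s
      unfolding h_def h1_def using assms(2)
      by (intro DERIV_chain2[OF F] derivative_eq_intros) auto
    have "((\<lambda>s. f (x * exp s)) has_real_derivative f' * x) (at 0)"
      using f by (intro DERIV_chain2[of f f']) (auto intro!: derivative_eq_intros)
    then show "(h1 has_real_derivative x * (f x + x * f')) (at 0)"
      unfolding h1_def by (auto intro!: derivative_eq_intros simp: algebra_simps)
    show "\<bar>h s\<bar> \<le> 1" for s
      using D.cdf_nonneg D.cdf_bounded_prob by (simp add: h_def)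
    show "sqrt (b n) > 0" for n
      using b by simp
    show "(\<lambda>n. sqrt (b n)) \<longlonglongrightarrow> 0"
      using tendsto_real_sqrt[OF b(2)] by simp
  qed
  moreover have "(\<integral>t. lognormal_survival t (ln x) (sqrt (b n)) \<partial>D)
      = (\<integral>z. h (sqrt (b n) * z) \<partial>std_normal_distribution)" for n
    unfolding h_def using assms by (intro integral_lognormal_survival DERIV_isCont[OF F]) auto
  ultimately show ?thesis
    using b by (simp add: h_def less_imp_le)
qed

text \<open>Dominated convergence with majorant 1: the only point where pointwise convergence may
  fail is \<open>x\<close>, a null set by continuity of the cdf there.\<close>

lemma lognormal_survival_L2_tendsto_indicator:
  assumes "real_distribution D" "x > 0" "isCont (cdf D) x"
    and \<sigma>: "\<And>n. \<sigma> n > 0" "\<sigma> \<longlonglongrightarrow> 0"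
  shows "(\<lambda>n. \<integral>t. (lognormal_survival t (ln x) (\<sigma> n) - indicator {..x} t)\<^sup>2 \<partial>D) \<longlonglongrightarrow> 0"
proof -
  interpret D: real_distribution D by fact
  have "(\<lambda>n. \<integral>t. (lognormal_survival t (ln x) (\<sigma> n) - indicator {..x} t)\<^sup>2 \<partial>D) \<longlonglongrightarrow> (\<integral>t. 0 \<partial>D)"
  proof (rule integral_dominated_convergence[where w = "\<lambda>_. 1"])
    have "emeasure D {x} = 0"
      using assms(3) by (simp add: D.isCont_cdf D.emeasure_eq_measure)
    then have "AE t in D. t \<noteq> x"
      by (intro AE_I[where N = "{x}"]) auto
    then show "AE t in D. (\<lambda>n. (lognormal_survival t (ln x) (\<sigma> n) - indicator {..x} t)\<^sup>2) \<longlonglongrightarrow> 0"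
    proof (rule AE_mp, intro AE_I2 impI)
      fix t assume "t \<noteq> x"
      then have "(\<lambda>n. (lognormal_survival t (ln x) (\<sigma> n) - indicator {..x} t)\<^sup>2)
          \<longlonglongrightarrow> (indicator {..x} t - indicator {..x} t)\<^sup>2"
        by (intro tendsto_intros lognormal_survival_tendsto_indicator assms)
      then show "(\<lambda>n. (lognormal_survival t (ln x) (\<sigma> n) - indicator {..x} t)\<^sup>2) \<longlonglongrightarrow> 0"
        by simp
    qed
    have "\<bar>lognormal_survival t (ln x) (\<sigma> n) - indicator {..x} t\<bar> \<le> 1" for n t
      using lognormal_survival_bounds[of t "ln x" "\<sigma> n"] by (auto simp: indicator_def)
    then show "AE t in D. norm ((lognormal_survival t (ln x) (\<sigma> n) - indicator {..x} t)\<^sup>2) \<le> 1" for n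
      by (simp add: abs_square_le_1)
  qed auto
  then show ?thesis
    by simp
qed

section \<open>Limit laws for normalised i.i.d. sums\<close>

text \<open>Adding the constant \<open>m\<close> is an affine map; replacing \<open>m\<close> by
  \<open>d n\<close> is then a deterministic perturbation of size
  \<open>\<bar>d n - m\<bar>\<close>.\<close>

lemma converges_in_law_normal_shift:
  assumes "prob_space M" "v > 0" "\<And>n. Y n \<in> borel_measurable M"
    and lim: "converges_in_law M Y (normal_distribution 0 v)" and d: "d \<longlonglongrightarrow> m"
  shows "converges_in_law M (\<lambda>n \<omega>. Y n \<omega> + d n) (normal_distribution m v)"
proof -
  interpret prob_space M by fact
  have [measurable]: "Y n \<in> borel_measurable M" for n
    by fact
  have "distr (normal_distribution 0 v) borel (\<lambda>z. m + 1 * z) = normal_distribution m v"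
    using assms(2) by (simp add: normal_distribution_eq_distr distr_distr comp_def)
  then have shifted: "converges_in_law M (\<lambda>n \<omega>. m + 1 * Y n \<omega>) (normal_distribution m v)"
    using converges_in_law_affine[of M Y _ m 1] assms real_distribution_normal_distribution by metis
  have "(\<lambda>n. \<bar>d n - m\<bar>) \<longlonglongrightarrow> 0"
    using tendsto_rabs[OF tendsto_diff[OF d tendsto_const[of m]]] by simp
  then show ?thesis
    by (intro converges_in_law_perturb[OF _ _ _ _ shifted] real_distribution_normal_distribution)
      (use assms in \<open>auto simp: prob_space\<close>)
qed

text \<open>The central limit theorem for Bernoulli variables with success probability
  \<open>cdf D x\<close>. Their variance is \<open>p - p^2\<close>, because an indicator equals its
  square, and it is positive because \<open>p\<close> lies strictly between 0 and 1.\<close>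

lemma (in prob_space) empirical_cdf_converges_in_law:
  fixes X :: "nat \<Rightarrow> 'a \<Rightarrow> real"
  assumes indep: "indep_vars (\<lambda>_. borel) X UNIV"
    and D: "\<And>i. distr M borel (X i) = D" and x: "0 < cdf D x" "cdf D x < 1"
  shows "converges_in_law M (\<lambda>n \<omega>. (\<Sum>i<n. indicator {..x} (X i \<omega>) - cdf D x) / sqrt n)
    (normal_distribution 0 (cdf D x * (1 - cdf D x)))"
proof -
  define p where "p = cdf D x"
  define v where "v = p * (1 - p)"
  have v: "v > 0"
    using x by (simp add: v_def p_def)
  have X[measurable]: "X i \<in> borel_measurable M" for i
    using indep by (auto simp: indep_vars_def2)
  define I where "I i \<omega> = (indicator {..x} (X i \<omega>) :: real)" for i \<omega>
  have I_meas[measurable]: "I i \<in> borel_measurable M" for i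
    unfolding I_def by measurable
  have I_int: "integrable M (I i)" for i
    by (rule integrable_const_bound[of _ 1]) (auto simp: I_def indicator_def)
  have I_square: "(I i \<omega>)\<^sup>2 = I i \<omega>" for i \<omega>
    by (simp add: I_def indicator_def)
  have I_mean: "expectation (I i) = p" for i
  proof -
    have "expectation (I i) = (\<integral>t. indicator {..x} t \<partial>distr M borel (X i))"
      unfolding I_def by (subst integral_distr) auto
    also have "\<dots> = p"
      by (simp add: D) (simp add: p_def cdf_def flip: D[of i])
    finally show ?thesis .
  qed
  have "weak_conv_m (\<lambda>n. distr M borel (\<lambda>\<omega>. (\<Sum>i<n. I i \<omega> - p) / sqrt (n * (sqrt v)\<^sup>2)))
      std_normal_distribution"
  proof (rule central_limit_theorem)
    show "indep_vars (\<lambda>_. borel) I UNIV"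
      unfolding I_def by (rule indep_vars_compose2[OF indep]) auto
    show "expectation (I i) = p" for i
      by (rule I_mean)
    show "sqrt v > 0"
      using v by simp
    show I2_int: "integrable M (\<lambda>\<omega>. (I i \<omega>)\<^sup>2)" for i
      using I_int by (simp add: I_square)
    have "variance (I i) = p - p\<^sup>2" for i
      by (subst variance_eq[OF I_int I2_int]) (simp only: I_square I_mean)
    then show "variance (I i) = (sqrt v)\<^sup>2" for i
      using v by (simp add: v_def power2_eq_square right_diff_distrib)
    show "distr M borel (I i) = distr D borel (indicator {..x})" for i
      by (simp add: distr_distr comp_def I_def[abs_def] flip: D[of i])
  qed
  then have "converges_in_law M (\<lambda>n \<omega>. (\<Sum>i<n. I i \<omega> - p) / sqrt (n * (sqrt v)\<^sup>2)) std_normal_distribution"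
    by (simp add: converges_in_law_def)
  \<comment> \<open>The central limit theorem normalises to unit variance; multiplying by
    \<open>sqrt v\<close> restores the scale \<open>sqrt n\<close>.\<close>
  then have "converges_in_law M (\<lambda>n \<omega>. 0 + sqrt v * ((\<Sum>i<n. I i \<omega> - p) / sqrt (n * (sqrt v)\<^sup>2)))
      (distr std_normal_distribution borel (\<lambda>z. 0 + sqrt v * z))"
    by (intro converges_in_law_affine prob_space_axioms real_dist_normal_dist) auto
  moreover have "0 + sqrt v * ((\<Sum>i<n. I i \<omega> - p) / sqrt (n * (sqrt v)\<^sup>2)) = (\<Sum>i<n. I i \<omega> - p) / sqrt n"
    for n :: nat and \<omega>
    using v by (simp add: real_sqrt_mult)
  ultimately show ?thesis
    using normal_distribution_eq_distr[OF v, of 0] by (simp only: I_def p_def v_def)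
qed

text \<open>The summand function \<open>g n\<close> may change with \<open>n\<close>: the L^1 norm
  of the normalised sum is at most the L^2 norm of \<open>g n\<close> under \<open>D\<close>,
  whatever the number of terms.\<close>

lemma (in prob_space) iid_centered_sum_L1_tendsto_0:
  fixes X :: "nat \<Rightarrow> 'a \<Rightarrow> real" and g :: "nat \<Rightarrow> real \<Rightarrow> real"
  assumes indep: "indep_vars (\<lambda>_. borel) X UNIV"
    and D: "\<And>i. distr M borel (X i) = D"
    and g[measurable]: "\<And>n. g n \<in> borel_measurable borel"
    and g2: "\<And>n. integrable D (\<lambda>t. (g n t)\<^sup>2)"
    and lim: "(\<lambda>n. \<integral>t. (g n t)\<^sup>2 \<partial>D) \<longlonglongrightarrow> 0"
  shows "(\<lambda>n. expectation (\<lambda>\<omega>. \<bar>(\<Sum>i<n. g n (X i \<omega>) - (\<integral>t. g n t \<partial>D)) / sqrt n\<bar>)) \<longlonglongrightarrow> 0"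
proof (rule tendsto_sandwich[OF always_eventually always_eventually tendsto_const])
  have X[measurable]: "X i \<in> borel_measurable M" for i
    using indep by (auto simp: indep_vars_def2)
  have trans: "expectation (\<lambda>\<omega>. h (X i \<omega>)) = (\<integral>t. h t \<partial>D)"
    "integrable M (\<lambda>\<omega>. h (X i \<omega>)) \<longleftrightarrow> integrable D h"
    if "h \<in> borel_measurable borel" for h :: "real \<Rightarrow> real" and i
    using that by (simp_all add: integral_distr integrable_distr_eq flip: D[of i])
  show "\<forall>n. expectation (\<lambda>\<omega>. \<bar>(\<Sum>i<n. g n (X i \<omega>) - (\<integral>t. g n t \<partial>D)) / sqrt n\<bar>)
      \<le> sqrt (\<integral>t. (g n t)\<^sup>2 \<partial>D)"
  proof
    fix n
    define m where "m = (\<integral>t. g n t \<partial>D)"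
    have int2: "integrable M (\<lambda>\<omega>. (g n (X i \<omega>))\<^sup>2)" for i
      using trans(2)[of "\<lambda>t. (g n t)\<^sup>2"] g2 by simp
    have int: "integrable M (\<lambda>\<omega>. g n (X i \<omega>))" for i
      by (rule square_integrable_imp_integrable[OF _ int2]) simp
    have mean: "expectation (\<lambda>\<omega>. g n (X i \<omega>)) = m" for i
      by (simp add: trans m_def)
    have "expectation (\<lambda>\<omega>. \<bar>(\<Sum>i<n. g n (X i \<omega>) - m) / sqrt n\<bar>) \<le> sqrt (\<integral>t. (g n t)\<^sup>2 \<partial>D)"
    proof (rule expectation_abs_normalized_sum_le)
      show "indep_vars (\<lambda>_. borel) (\<lambda>i \<omega>. g n (X i \<omega>) - m) UNIV"
        by (rule indep_vars_compose2[OF indep]) auto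
      show "expectation (\<lambda>\<omega>. g n (X i \<omega>) - m) = 0" for i
        using int mean by (simp add: prob_space)
      show "integrable M (\<lambda>\<omega>. (g n (X i \<omega>) - m)\<^sup>2)" for i
        using int int2 by (simp add: power2_diff)
      \<comment> \<open>The variance is the second moment minus \<open>m^2\<close>.\<close>
      show "expectation (\<lambda>\<omega>. (g n (X i \<omega>) - m)\<^sup>2) \<le> (\<integral>t. (g n t)\<^sup>2 \<partial>D)" for i
        using variance_eq[OF int int2, of i] mean[of i] trans(1)[of "\<lambda>t. (g n t)\<^sup>2" i] by simp
    qed
    then show "expectation (\<lambda>\<omega>. \<bar>(\<Sum>i<n. g n (X i \<omega>) - (\<integral>t. g n t \<partial>D)) / sqrt n\<bar>)
        \<le> sqrt (\<integral>t. (g n t)\<^sup>2 \<partial>D)"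
      by (simp add: m_def)
  qed
  show "(\<lambda>n. sqrt (\<integral>t. (g n t)\<^sup>2 \<partial>D)) \<longlonglongrightarrow> 0"
    using tendsto_real_sqrt[OF lim] by simp
qed (auto intro!: Bochner_Integration.integral_nonneg)

section \<open>Asymptotic normality of the lognormal kernel estimator\<close>

theorem proposition6p4:
  fixes M :: "'a measure"
    and X :: "nat \<Rightarrow> 'a \<Rightarrow> real"
    and F f f' :: "real \<Rightarrow> real"
    and b :: "nat \<Rightarrow> real"
    and x :: real
  assumes "prob_space M"
    and "prob_space.indep_vars M (\<lambda>_. borel) X UNIV"
    and "\<And>i. cdf (distr M borel (X i)) = F"
    and "\<And>y. y < 0 \<Longrightarrow> F y = 0"
    and "\<And>y. y > 0 \<Longrightarrow> (F has_real_derivative f y) (at y)"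
    and "\<And>y. y > 0 \<Longrightarrow> (f has_real_derivative f' y) (at y)"
    and "continuous_on {0<..} f" and "bounded (f ` {0<..})"
    and "continuous_on {0<..} f'" and "bounded (f' ` {0<..})"
    and "\<And>n. b n > 0" and "b \<longlonglongrightarrow> 0"
    and "x > 0" and "0 < F x" and "F x < 1"
  shows "converges_in_law M
           (\<lambda>n \<omega>. sqrt (real n) * (lognormal_cdf_estimator X n (b n) x \<omega>
                     - integral\<^sup>L M (lognormal_cdf_estimator X n (b n) x)))
           (normal_distribution 0 (F x * (1 - F x)))
       \<and> ((\<lambda>n. sqrt (real n) * b n) \<longlonglongrightarrow> 0 \<longrightarrow>
            converges_in_law M
              (\<lambda>n \<omega>. sqrt (real n) * (lognormal_cdf_estimator X n (b n) x \<omega> - F x))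
              (normal_distribution 0 (F x * (1 - F x))))
       \<and> (\<forall>c>0. (\<lambda>n. sqrt (real n) * b n) \<longlonglongrightarrow> c \<longrightarrow>
            converges_in_law M
              (\<lambda>n \<omega>. sqrt (real n) * (lognormal_cdf_estimator X n (b n) x \<omega> - F x))
              (normal_distribution (c * (x / 2 * (f x + x * f' x))) (F x * (1 - F x))))"
proof -
  interpret prob_space M by fact
  note indep = assms(2) and b = assms(11,12) and x = assms(13-15)
  define D where "D = distr M borel (X 0)"
  define v where "v = F x * (1 - F x)"
  define \<beta> where "\<beta> = x / 2 * (f x + x * f' x)"
  have v: "v > 0"
    using x by (simp add: v_def)
  have X[measurable]: "X i \<in> borel_measurable M" for i
    using indep by (auto simp: indep_vars_def2)
  \<comment> \<open>A law on the real line is determined by its cdf, so the common \<open>F\<close>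
    makes the variables identically distributed.\<close>
  have distr_X: "distr M borel (X i) = D" for i
    unfolding D_def by (intro cdf_unique real_distribution_distr) (auto simp: assms(3))
  have cdf_D: "cdf D = F"
    by (simp add: D_def assms(3))
  have D_dist: "real_distribution D"
    unfolding D_def by (intro real_distribution_distr X)
  interpret D: real_distribution D by (fact D_dist)
  have trans: "expectation (\<lambda>\<omega>. h (X i \<omega>)) = (\<integral>t. h t \<partial>D)"
    if "h \<in> borel_measurable borel" for h :: "real \<Rightarrow> real" and i
    using that by (simp add: integral_distr flip: distr_X[of i])

  define K where "K n t = lognormal_survival t (ln x) (sqrt (b n))" for n t
  define I where "I t = (indicator {..x} t :: real)" for t
  define \<kappa> where "\<kappa> n = (\<integral>t. K n t \<partial>D)" for n
  \<comment> \<open>\<open>Y\<close> is the centred and normalised smoothed estimator;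
    \<open>W\<close> is its counterpart for the empirical distribution function.\<close>
  define Y where "Y n \<omega> = (\<Sum>i<n. K n (X i \<omega>) - \<kappa> n) / sqrt n" for n \<omega>
  define W where "W n \<omega> = (\<Sum>i<n. I (X i \<omega>) - F x) / sqrt n" for n \<omega>
  have meas[measurable]: "K n \<in> borel_measurable borel" "I \<in> borel_measurable borel" for n
    unfolding K_def I_def by measurable
  have Y_meas[measurable]: "Y n \<in> borel_measurable M" for n
    unfolding Y_def by measurable
  have W_meas[measurable]: "W n \<in> borel_measurable M" for n
    unfolding W_def by measurable
  have K_bound: "\<bar>K n t\<bar> \<le> 1" for n t
    using lognormal_survival_bounds[of t] by (simp add: K_def)
  have KI_bound: "\<bar>K n t - I t\<bar> \<le> 1" for n t
    using lognormal_survival_bounds[of t "ln x" "sqrt (b n)"] by (auto simp: K_def I_def indicator_def)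
  have K_int: "integrable D (K n)" and I_int: "integrable D I" for n
    by (rule D.integrable_const_bound[of _ 1]; use K_bound in \<open>simp add: I_def indicator_def\<close>)+
  have K_intM: "integrable M (\<lambda>\<omega>. K n (X i \<omega>))" and I_intM: "integrable M (\<lambda>\<omega>. I (X i \<omega>))" for n i
    by (rule integrable_const_bound[of _ 1]; use K_bound in \<open>simp add: I_def indicator_def\<close>)+
  have I_mean: "(\<integral>t. I t \<partial>D) = F x"
    unfolding I_def cdf_D[symmetric] by (simp add: cdf_def)

  have W_lim: "converges_in_law M W (normal_distribution 0 v)"
    using empirical_cdf_converges_in_law[OF indep distr_X, of x] x
    by (simp add: cdf_D W_def[abs_def] I_def v_def)
  have Y_lim: "converges_in_law M Y (normal_distribution 0 v)"
  proof (rule converges_in_law_perturb[OF prob_space_axioms W_meas Y_meas _ W_lim])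
    show "real_distribution (normal_distribution 0 v)"
      using v by (rule real_distribution_normal_distribution)
    show "integrable M (\<lambda>\<omega>. Y n \<omega> - W n \<omega>)" for n
      unfolding Y_def W_def using K_intM I_intM by simp
    have "(\<lambda>n. expectation (\<lambda>\<omega>. \<bar>(\<Sum>i<n. (K n (X i \<omega>) - I (X i \<omega>)) - (\<integral>t. K n t - I t \<partial>D)) / sqrt n\<bar>)) \<longlonglongrightarrow> 0"
    proof (rule iid_centered_sum_L1_tendsto_0[OF indep distr_X])
      show "integrable D (\<lambda>t. (K n t - I t)\<^sup>2)" for n
        by (rule D.integrable_const_bound[of _ 1]) (use KI_bound in \<open>auto simp: abs_square_le_1\<close>)
      show "(\<lambda>n. \<integral>t. (K n t - I t)\<^sup>2 \<partial>D) \<longlonglongrightarrow> 0"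
        unfolding K_def I_def
      proof (rule lognormal_survival_L2_tendsto_indicator[OF D_dist \<open>x > 0\<close>])
        show "isCont (cdf D) x"
          unfolding cdf_D by (rule DERIV_isCont[OF assms(5)[OF \<open>x > 0\<close>]])
        show "(\<lambda>n. sqrt (b n)) \<longlonglongrightarrow> 0"
          using tendsto_real_sqrt[OF b(2)] by simp
      qed (use b(1) in simp)
    qed simp
    \<comment> \<open>The two centring constants \<open>\<kappa> n\<close> and \<open>F x\<close>
      combine to the mean of \<open>K n - I\<close>, so the difference is again a centred i.i.d.
      sum.\<close>
    moreover have "Y n \<omega> - W n \<omega>
        = (\<Sum>i<n. (K n (X i \<omega>) - I (X i \<omega>)) - (\<integral>t. K n t - I t \<partial>D)) / sqrt n" for n \<omega>
      using K_int I_int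
      by (simp add: Y_def W_def \<kappa>_def I_mean algebra_simps sum.distrib sum_subtractf
          flip: diff_divide_distrib)
    ultimately show "(\<lambda>n. expectation (\<lambda>\<omega>. \<bar>Y n \<omega> - W n \<omega>\<bar>)) \<longlonglongrightarrow> 0"
      by simp
  qed

  \<comment> \<open>Splits the error about any centre \<open>a\<close> into the random part
    \<open>Y\<close> and a deterministic shift. All three claims follow by choosing
    \<open>a\<close>. At \<open>n = 0\<close> both sides vanish.\<close>
  have est: "sqrt n * (lognormal_cdf_estimator X n (b n) x \<omega> - a) = Y n \<omega> + sqrt n * (\<kappa> n - a)" for n a \<omega>
  proof (cases "n = 0")
    case False
    have "sqrt n * (1 / n * S - a) = (S - n * k) / sqrt n + sqrt n * (k - a)" for S k :: real
      using False by (simp add: field_simps flip: real_sqrt_mult)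
    then show ?thesis
      by (simp add: lognormal_cdf_estimator_def Y_def K_def sum_subtractf)
  qed (simp add: Y_def)
  \<comment> \<open>The factor \<open>sqrt n\<close> covers \<open>n = 0\<close>, where the
    estimator is identically 0 and its mean may differ from \<open>\<kappa> 0\<close>.\<close>
  have est_mean: "sqrt n * (\<kappa> n - expectation (lognormal_cdf_estimator X n (b n) x)) = 0" for n
  proof (cases "n = 0")
    case False
    have "expectation (lognormal_cdf_estimator X n (b n) x) = 1 / n * expectation (\<lambda>\<omega>. \<Sum>i<n. K n (X i \<omega>))"
      by (simp add: lognormal_cdf_estimator_def[abs_def] K_def)
    also have "expectation (\<lambda>\<omega>. \<Sum>i<n. K n (X i \<omega>)) = n * \<kappa> n"
      using K_intM by (simp add: trans \<kappa>_def)
    finally show ?thesis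
      using False by simp
  qed simp

  have bias: "(\<lambda>n. (\<kappa> n - F x) / b n) \<longlonglongrightarrow> \<beta>"
    unfolding \<kappa>_def K_def \<beta>_def cdf_D[symmetric]
    using x b by (intro lognormal_bias_tendsto D_dist) (auto simp: cdf_D assms(5,6))
  have shift: "converges_in_law M (\<lambda>n \<omega>. sqrt n * (lognormal_cdf_estimator X n (b n) x \<omega> - F x))
      (normal_distribution (c * \<beta>) v)" if "(\<lambda>n. sqrt n * b n) \<longlonglongrightarrow> c" for c
  proof -
    \<comment> \<open>The scaled bias is the product of \<open>sqrt n * b n\<close> and the bias per
      unit of \<open>b n\<close>, each of which converges.\<close>
    have "(\<lambda>n. (sqrt n * b n) * ((\<kappa> n - F x) / b n)) \<longlonglongrightarrow> c * \<beta>"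
      by (intro tendsto_mult that bias)
    moreover have "(sqrt n * b n) * ((\<kappa> n - F x) / b n) = sqrt n * (\<kappa> n - F x)" for n
      using b(1)[of n] by simp
    ultimately show ?thesis
      unfolding est by (intro converges_in_law_normal_shift prob_space_axioms v Y_meas Y_lim) simp
  qed
  \<comment> \<open>Centring at the mean makes the shift vanish exactly and gives the first claim.
    The second is the case \<open>c = 0\<close> of \<open>shift\<close>, and the third is
    \<open>shift\<close> for positive \<open>c\<close>.\<close>
  show ?thesis
    using Y_lim shift[of 0] shift unfolding est[of _ _ "expectation _"] est_mean
    by (simp add: v_def \<beta>_def)
qed

end
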